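(* Let $\mathfrak{n}$ be the necklace Lie algebra in two variables $x,x^*$ and let $\mathfrak{c}$ be its center. For all $n\in\mathbb{N}$, the element $c_n=[x,x^*]^n\in\mathfrak{n}$ (the class in $\mathfrak n$ of $(xx^*-x^*x)^n\in\mathbb{C}\langle x,x^*\rangle$) is a central element of $\mathfrak{n}$. These elements are distinct and nonzero for $n>1$, and hence $\mathfrak{c}$ is infinite dimensional.
   Context: Let $A=\mathbb{C}\langle x,x^*\rangle$. The canonical symplectic double bracket on $A$ is the bilinear map $\{\!\{-,-\}\!\}:A\otimes A\to A\otimes A$ determined by $\{\!\{x,x\}\!\}=\{\!\{x^*,x^*\}\!\}=0$, $\{\!\{x,x^*\}\!\}=1\otimes1$, together with $\{\!\{a,b\}\!\}=-\{\!\{b,a\}\!\}^{o}$ (where $(u\otimes v)^o=v\otimes u$) and $\{\!\{a,bc\}\!\}=b\{\!\{a,c\}\!\}+\{\!\{a,b\}\!\}c$ for the outer bimodule structure $a(u\otimes v)c=(au)\otimes(vc)$. With $\mu$ the multiplication of $A$, the map $(a,b)\mapsto\mu(\{\!\{a,b\}\!\})$ induces a Lie bracket on the vector space quotient $\mathfrak{n}=A/[A,A]$, where $[A,A]$ is the vector space spanned by all commutators; this is the necklace Lie algebra in two variables. *)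

theory Defs
  imports Complex_Main "HOL-Library.Poly_Mapping" "HOL-Library.Product_Plus"
begin

section \<open>Monoid algebras as complex vector spaces\<close>

text \<open>For a monoid \<open>'m\<close> (written additively, but not assumed commutative), the ring
  \<open>'m \<Rightarrow>\<^sub>0 complex\<close> of finitely supported functions with convolution is the monoid algebra
  of \<open>'m\<close> over the complex numbers.\<close>

definition pscale :: "complex \<Rightarrow> ('m \<Rightarrow>\<^sub>0 complex) \<Rightarrow> ('m \<Rightarrow>\<^sub>0 complex)" (infixr \<open>*:\<close> 75)
  where "c *: p = Poly_Mapping.map ((*) c) p"

lemma lookup_pscale [simp]: "Poly_Mapping.lookup (c *: p) k = c * Poly_Mapping.lookup p k"
  unfolding pscale_def by (simp add: Poly_Mapping.map.rep_eq when_def)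

interpretation pm: vector_space "pscale :: complex \<Rightarrow> ('m \<Rightarrow>\<^sub>0 complex) \<Rightarrow> ('m \<Rightarrow>\<^sub>0 complex)"
  by unfold_locales
    (auto intro!: poly_mapping_eqI simp: lookup_add algebra_simps)

lemma pscale_single: "c *: Poly_Mapping.single k d = Poly_Mapping.single k (c * d)"
  by (rule poly_mapping_eqI) (simp add: lookup_single when_def)

lemma pscale_conv_mult: "c *: p = Poly_Mapping.single 0 c * p"
  for p :: "'m::monoid_add \<Rightarrow>\<^sub>0 complex"
  unfolding pscale_def by (rule mult_map_scale_conv_mult)

lemma single_add_induct [case_names single add]:
  fixes p :: "'m \<Rightarrow>\<^sub>0 complex"
  assumes single: "\<And>k c. P (Poly_Mapping.single k c)"
    and add: "\<And>p q. P p \<Longrightarrow> P q \<Longrightarrow> P (p + q)"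
  shows "P p"
proof -
  have zero: "P 0" using single[of undefined 0] by simp
  have "P (\<Sum>k\<in>S. Poly_Mapping.single k (Poly_Mapping.lookup p k))" if "finite S" for S
    using that by (induction S rule: finite_induct) (simp_all add: zero single add)
  moreover have "(\<Sum>k\<in>Poly_Mapping.keys p. Poly_Mapping.single k (Poly_Mapping.lookup p k)) = p"
    by (rule poly_mapping_eqI)
      (auto simp: lookup_sum lookup_single when_def in_keys_iff sum.delta)
  ultimately show ?thesis by (metis finite_keys)
qed

lemma basis_induct [case_names basis scale add]:
  fixes p :: "'m \<Rightarrow>\<^sub>0 complex"
  assumes "\<And>k. P (Poly_Mapping.single k 1)" "\<And>c p. P p \<Longrightarrow> P (c *: p)"
    "\<And>p q. P p \<Longrightarrow> P q \<Longrightarrow> P (p + q)"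
  shows "P p"
proof (induction p rule: single_add_induct)
  case (single k c)
  show ?case using assms(2)[OF assms(1)[of k], of c] by (simp add: pscale_single)
next
  case (add p q)
  then show ?case by (rule assms(3))
qed

lemma pscale_mult_left [simp]: "(c *: p) * q = c *: (p * q)"
  for p q :: "'m::monoid_add \<Rightarrow>\<^sub>0 complex"
  by (simp add: pscale_conv_mult mult.assoc)

lemma single_0_commute: "Poly_Mapping.single 0 c * p = p * Poly_Mapping.single 0 c"
  for p :: "'m::monoid_add \<Rightarrow>\<^sub>0 complex"
proof (induction p rule: single_add_induct)
  case (single k c)
  show ?case by (simp add: mult_single mult.commute)
next
  case (add p q)
  then show ?case by (simp add: algebra_simps)
qed

lemma pscale_mult_right [simp]: "p * (c *: q) = c *: (p * q)"
  for p q :: "'m::monoid_add \<Rightarrow>\<^sub>0 complex"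
  by (metis pscale_conv_mult single_0_commute mult.assoc)

lemma linear_iff_pscale:
  "Vector_Spaces.linear pscale pscale f \<longleftrightarrow>
    (\<forall>p q. f (p + q) = f p + f q) \<and> (\<forall>c p. f (c *: p) = c *: f p)"
  for f :: "('m \<Rightarrow>\<^sub>0 complex) \<Rightarrow> ('n \<Rightarrow>\<^sub>0 complex)"
proof
  assume "Vector_Spaces.linear pscale pscale f"
  then interpret Vector_Spaces.linear pscale pscale f .
  show "(\<forall>p q. f (p + q) = f p + f q) \<and> (\<forall>c p. f (c *: p) = c *: f p)"
    by (simp add: add scale)
next
  assume "(\<forall>p q. f (p + q) = f p + f q) \<and> (\<forall>c p. f (c *: p) = c *: f p)"
  then show "Vector_Spaces.linear pscale pscale f"
    by unfold_locales auto
qed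

definition lin_ext :: "('m \<Rightarrow> ('n \<Rightarrow>\<^sub>0 complex)) \<Rightarrow> ('m \<Rightarrow>\<^sub>0 complex) \<Rightarrow> ('n \<Rightarrow>\<^sub>0 complex)"
  where "lin_ext f p = (\<Sum>k\<in>Poly_Mapping.keys p. Poly_Mapping.lookup p k *: f k)"

lemma lin_ext_superset:
  assumes "finite S" "Poly_Mapping.keys p \<subseteq> S"
  shows "lin_ext f p = (\<Sum>k\<in>S. Poly_Mapping.lookup p k *: f k)"
  unfolding lin_ext_def
  by (rule sum.mono_neutral_left[OF assms]) (auto simp: in_keys_iff)

lemma lin_ext_single [simp]: "lin_ext f (Poly_Mapping.single k c) = c *: f k"
  by (subst lin_ext_superset[of "{k}"]) auto

lemma lin_ext_add [simp]: "lin_ext f (p + q) = lin_ext f p + lin_ext f q"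
proof -
  let ?S = "Poly_Mapping.keys p \<union> Poly_Mapping.keys q"
  have "lin_ext f (p + q) = (\<Sum>k\<in>?S. Poly_Mapping.lookup (p + q) k *: f k)"
    by (rule lin_ext_superset) (auto dest: subsetD[OF keys_add])
  moreover have "lin_ext f p = (\<Sum>k\<in>?S. Poly_Mapping.lookup p k *: f k)"
    by (rule lin_ext_superset) auto
  moreover have "lin_ext f q = (\<Sum>k\<in>?S. Poly_Mapping.lookup q k *: f k)"
    by (rule lin_ext_superset) auto
  ultimately show ?thesis
    by (simp add: lookup_add pm.scale_left_distrib sum.distrib)
qed

lemma lin_ext_pscale [simp]: "lin_ext f (c *: p) = c *: lin_ext f p"
proof -
  have "lin_ext f (c *: p) = (\<Sum>k\<in>Poly_Mapping.keys p. Poly_Mapping.lookup (c *: p) k *: f k)"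
    by (rule lin_ext_superset) (auto simp: in_keys_iff)
  then show ?thesis
    by (simp add: lin_ext_def pm.scale_sum_right)
qed

lemma lin_ext_0 [simp]: "lin_ext f 0 = 0"
  by (simp add: lin_ext_def)

lemma lin_ext_uminus [simp]: "lin_ext f (- p) = - lin_ext f p"
  using lin_ext_add[of f p "- p"] by (simp add: eq_neg_iff_add_eq_0 add.commute)

lemma lin_ext_diff [simp]: "lin_ext f (p - q) = lin_ext f p - lin_ext f q"
  using lin_ext_add[of f p "- q"] by simp

lemma lin_ext_fun_add: "lin_ext (\<lambda>k. f k + g k) p = lin_ext f p + lin_ext g p"
  by (simp add: lin_ext_def pm.scale_right_distrib sum.distrib)

lemma lin_ext_fun_pscale: "lin_ext (\<lambda>k. c *: f k) p = c *: lin_ext f p"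
  by (simp add: lin_ext_def pm.scale_sum_right mult.commute)


section \<open>The free algebra on two generators\<close>

datatype letter = X | X_star

text \<open>Lists under concatenation are the free monoid.\<close>

instantiation list :: (type) monoid_add
begin

definition zero_list :: "'a list" where "0 = []"

definition plus_list :: "'a list \<Rightarrow> 'a list \<Rightarrow> 'a list" where "xs + ys = xs @ ys"

instance
  by standard (simp_all add: zero_list_def plus_list_def)

end

type_synonym falg = "letter list \<Rightarrow>\<^sub>0 complex"

text \<open>The tensor square of the free algebra: the space with basis all pairs of words.  Its ring
  structure coming from the product monoid is the usual one on a tensor product of algebras.\<close>

type_synonym falg2 = "(letter list \<times> letter list) \<Rightarrow>\<^sub>0 complex"

abbreviation word :: "letter list \<Rightarrow> falg"
  where "word w \<equiv> Poly_Mapping.single w 1"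

abbreviation word2 :: "letter list \<Rightarrow> letter list \<Rightarrow> falg2"
  where "word2 u v \<equiv> Poly_Mapping.single (u, v) 1"

definition gen_x :: falg where "gen_x = word [X]"

definition gen_x_star :: falg where "gen_x_star = word [X_star]"

definition tensor :: "falg \<Rightarrow> falg \<Rightarrow> falg2" (infixr \<open>\<otimes>\<close> 72)
  where "a \<otimes> b = lin_ext (\<lambda>u. lin_ext (\<lambda>v. word2 u v) b) a"

definition flip :: "falg2 \<Rightarrow> falg2"
  where "flip = lin_ext (\<lambda>(u, v). word v \<otimes> word u)"

definition mul_map :: "falg2 \<Rightarrow> falg"
  where "mul_map = lin_ext (\<lambda>(u, v). word u * word v)"

definition outer_act :: "falg \<Rightarrow> falg2 \<Rightarrow> falg \<Rightarrow> falg2"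
  where "outer_act a t c = lin_ext (\<lambda>(u, v). (a * word u) \<otimes> (word v * c)) t"

lemma word_mult [simp]: "word u * word v = word (u @ v)"
  by (simp add: mult_single plus_list_def)

lemma word2_mult [simp]: "word2 u v * word2 u' v' = word2 (u @ u') (v @ v')"
  by (simp add: mult_single plus_list_def)

lemma one_falg: "(1 :: falg) = word []"
  by (metis single_one zero_list_def)

lemma one_falg2: "(1 :: falg2) = word2 [] []"
  by (metis single_one zero_list_def zero_prod_def)

lemma tensor_simps [simp]:
  "(a + a') \<otimes> b = a \<otimes> b + a' \<otimes> b"
  "a \<otimes> (b + b') = a \<otimes> b + a \<otimes> b'"
  "(c *: a) \<otimes> b = c *: (a \<otimes> b)"
  "a \<otimes> (c *: b) = c *: (a \<otimes> b)"
  "word u \<otimes> word v = word2 u v"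
  by (simp_all add: tensor_def lin_ext_fun_add lin_ext_fun_pscale)

lemma tensor_mult: "(a \<otimes> b) * (a' \<otimes> b') = (a * a') \<otimes> (b * b')"
proof (induction a rule: basis_induct)
  case (basis k)
  show ?case
  proof (induction b rule: basis_induct)
    case (basis l)
    show ?case
    proof (induction a' rule: basis_induct)
      case (basis m)
      show ?case by (induction b' rule: basis_induct) (simp_all add: algebra_simps)
    qed (simp_all add: algebra_simps)
  qed (simp_all add: algebra_simps)
qed (simp_all add: algebra_simps)

lemma outer_act_conv_mult: "outer_act a t c = (a \<otimes> 1) * t * (1 \<otimes> c)"
proof (induction t rule: basis_induct)
  case (basis k)
  obtain u v where k: "k = (u, v)" by force
  have "outer_act a (word u \<otimes> word v) c = (a * word u) \<otimes> (word v * c)"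
    by (simp add: outer_act_def)
  also have "\<dots> = (a \<otimes> 1) * (word u \<otimes> word v) * (1 \<otimes> c)"
    by (simp add: tensor_mult del: tensor_simps)
  finally show ?case by (simp add: k)
qed (simp_all add: outer_act_def algebra_simps)

lemma flip_simps [simp]:
  "flip (s + t) = flip s + flip t" "flip (c *: t) = c *: flip t" "flip 0 = 0"
  "flip (- t) = - flip t" "flip (word2 u v) = word2 v u"
  by (simp_all add: flip_def)

lemma flip_mult: "flip (s * t) = flip s * flip t"
proof (induction s rule: basis_induct)
  case (basis k)
  show ?case
  proof (induction t rule: basis_induct)
    case (basis l)
    then show ?case by (cases k; cases l) simp
  qed (simp_all add: algebra_simps)
qed (simp_all add: algebra_simps)

lemma flip_flip [simp]: "flip (flip t) = t"
proof (induction t rule: basis_induct)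
  case (basis k)
  then show ?case by (cases k) simp
qed simp_all

lemma mul_map_simps [simp]:
  "mul_map (s + t) = mul_map s + mul_map t" "mul_map (c *: t) = c *: mul_map t"
  "mul_map (- t) = - mul_map t" "mul_map (s - t) = mul_map s - mul_map t"
  "mul_map 0 = 0" "mul_map (word2 u v) = word (u @ v)"
  by (simp_all add: mul_map_def)

lemma mul_map_outer_act: "mul_map (outer_act a t c) = a * mul_map t * c"
proof (induction t rule: basis_induct)
  case (basis k)
  have *: "mul_map (p \<otimes> q) = p * q" for p q
  proof (induction p rule: basis_induct)
    case (basis k)
    show ?case by (induction q rule: basis_induct) (simp_all add: algebra_simps)
  qed (simp_all add: algebra_simps)
  show ?case
    by (cases k) (simp add: outer_act_def * mult.assoc flip: word_mult)
qed (simp_all add: outer_act_def algebra_simps)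


section \<open>The canonical symplectic double bracket\<close>

definition is_symplectic_double_bracket :: "(falg \<Rightarrow> falg \<Rightarrow> falg2) \<Rightarrow> bool"
  where "is_symplectic_double_bracket D \<longleftrightarrow>
    (\<forall>a. Vector_Spaces.linear pscale pscale (\<lambda>b. D a b)) \<and>
    (\<forall>b. Vector_Spaces.linear pscale pscale (\<lambda>a. D a b)) \<and>
    D gen_x gen_x = 0 \<and> D gen_x_star gen_x_star = 0 \<and> D gen_x gen_x_star = 1 \<otimes> 1 \<and>
    (\<forall>a b. D a b = - flip (D b a)) \<and>
    (\<forall>a b c. D a (b * c) = outer_act b (D a c) 1 + outer_act 1 (D a b) c)"

definition double_bracket :: "falg \<Rightarrow> falg \<Rightarrow> falg2"
  where "double_bracket = (THE D. is_symplectic_double_bracket D)"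

text \<open>We show that the definite description is justified.  For existence, the bracket of two words
  is the sum over all pairs of positions, one in each word, of
  \<open>\<omega> a b \<sqdot> v\<^sub>1u\<^sub>2 \<otimes> u\<^sub>1v\<^sub>2\<close> where \<open>u = u\<^sub>1au\<^sub>2\<close> and \<open>v = v\<^sub>1bv\<^sub>2\<close>.\<close>

fun omega :: "letter \<Rightarrow> letter \<Rightarrow> complex" where
  "omega X X_star = 1"
| "omega X_star X = - 1"
| "omega X X = 0"
| "omega X_star X_star = 0"

lemma omega_swap: "omega b a = - omega a b"
  by (cases a; cases b) simp_all

fun db_letter :: "letter \<Rightarrow> letter list \<Rightarrow> falg2" where
  "db_letter a [] = 0"
| "db_letter a (b # v) = omega a b *: word2 [] v + word2 [b] [] * db_letter a v"

fun db_word :: "letter list \<Rightarrow> letter list \<Rightarrow> falg2" where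
  "db_word [] v = 0"
| "db_word (a # u) v = db_letter a v * word2 u [] + word2 [] [a] * db_word u v"

definition db :: "falg \<Rightarrow> falg \<Rightarrow> falg2"
  where "db a b = lin_ext (\<lambda>u. lin_ext (\<lambda>v. db_word u v) b) a"

lemma db_letter_append:
  "db_letter a (v @ w) = word2 v [] * db_letter a w + db_letter a v * word2 [] w"
proof (induction v)
  case Nil
  show ?case by (simp flip: one_falg2)
next
  case (Cons b v)
  have "word2 [b] [] * (word2 v [] * t) = word2 (b # v) [] * t" for t
    by (simp flip: mult.assoc)
  then show ?case by (simp add: Cons algebra_simps)
qed

lemma db_word_append_right:
  "db_word u (v @ w) = word2 v [] * db_word u w + db_word u v * word2 [] w"
proof (induction u)
  case Nil
  show ?case by simp
next
  case (Cons a u)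
  have 1: "word2 [] w * word2 u [] = word2 u [] * word2 [] w"
    and 2: "word2 [] [a] * word2 v [] = word2 v [] * word2 [] [a]" by simp_all
  have "db_word (a # u) (v @ w) =
      word2 v [] * db_letter a w * word2 u [] + db_letter a v * (word2 [] w * word2 u [])
      + ((word2 [] [a] * word2 v []) * db_word u w + word2 [] [a] * db_word u v * word2 [] w)"
    by (simp only: db_word.simps db_letter_append Cons distrib_left distrib_right mult.assoc)
  then show ?case unfolding 1 2
    by (simp only: db_word.simps distrib_left distrib_right mult.assoc
        add.assoc add.commute add.left_commute)
qed

lemma db_word_Nil_right [simp]: "db_word u [] = 0"
  by (induction u) simp_all

lemma db_letter_eq: "db_letter a v = - flip (db_word v [a])"
proof (induction v)
  case Nil
  show ?case by simp
next
  case (Cons b v)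
  have "flip (db_word (b # v) [a]) = omega b a *: word2 [] v + word2 [b] [] * flip (db_word v [a])"
    by (simp add: flip_mult)
  then show ?case by (simp add: Cons omega_swap[of b a])
qed

lemma db_word_swap: "db_word u v = - flip (db_word v u)"
proof (induction u)
  case Nil
  show ?case by simp
next
  case (Cons a u)
  have "flip (db_word v ([a] @ u)) =
      word2 [] [a] * flip (db_word v u) + flip (db_word v [a]) * word2 u []"
    by (simp only: db_word_append_right flip_simps flip_mult)
  then show ?case by (simp add: Cons db_letter_eq)
qed

lemma db_simps [simp]:
  "db (a + a') b = db a b + db a' b" "db a (b + b') = db a b + db a b'"
  "db (c *: a) b = c *: db a b" "db a (c *: b) = c *: db a b"
  "db (word u) (word v) = db_word u v"
  by (simp_all add: db_def lin_ext_fun_add lin_ext_fun_pscale)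

lemma db_swap: "db a b = - flip (db b a)"
proof (induction a rule: basis_induct)
  case (basis k)
  show ?case
    by (induction b rule: basis_induct) (simp_all add: db_word_swap[of k])
qed simp_all

lemma db_leibniz: "db a (b * c) = outer_act b (db a c) 1 + outer_act 1 (db a b) c"
  unfolding outer_act_conv_mult
proof (induction a rule: basis_induct)
  case (basis k)
  show ?case
  proof (induction b rule: basis_induct)
    case (basis l)
    show ?case
    proof (induction c rule: basis_induct)
      case (basis m)
      show ?case
        by (simp add: db_word_append_right one_falg flip: one_falg2)
    qed (simp_all add: algebra_simps)
  qed (simp_all add: algebra_simps)
qed (simp_all add: algebra_simps)

lemma is_symplectic_double_bracket_db: "is_symplectic_double_bracket db"
  unfolding is_symplectic_double_bracket_def linear_iff_pscale
proof (intro conjI allI)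
  show "db a b = - flip (db b a)" for a b by (rule db_swap)
  show "db a (b * c) = outer_act b (db a c) 1 + outer_act 1 (db a b) c" for a b c
    by (rule db_leibniz)
qed (simp_all add: gen_x_def gen_x_star_def one_falg flip: one_falg2)

lemma is_symplectic_double_bracket_unique:
  assumes D: "is_symplectic_double_bracket D" and E: "is_symplectic_double_bracket E"
  shows "D = E"
proof -
  have add: "F (a + a') b = F a b + F a' b" "F a (b + b') = F a b + F a b'"
    and scale: "F (c *: a) b = c *: F a b" "F a (c *: b) = c *: F a b"
    and swap: "F a b = - flip (F b a)"
    and leib: "F a (b * d) = outer_act b (F a d) 1 + outer_act 1 (F a b) d"
    and gens: "F gen_x gen_x = 0" "F gen_x_star gen_x_star = 0" "F gen_x gen_x_star = 1 \<otimes> 1"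
    if "is_symplectic_double_bracket F" for F a a' b b' c d
    using that unfolding is_symplectic_double_bracket_def linear_iff_pscale by blast+
  have one: "F a 1 = 0" if F: "is_symplectic_double_bracket F" for F a
  proof -
    have "F a 1 = F a 1 + F a 1"
      using leib[OF F, of a 1 1]
      by (simp add: outer_act_conv_mult one_falg flip: one_falg2)
    then show ?thesis by simp
  qed
  have extend: "D a (word v) = E a (word v)"
    if "\<And>b. D a (word [b]) = E a (word [b])" for a v
  proof (induction v)
    case Nil
    show ?case using one[OF D] one[OF E] by (simp add: one_falg)
  next
    case (Cons b v)
    have "word (b # v) = word [b] * word v" by simp
    then show ?case using leib[OF D] leib[OF E] Cons that by metis
  qed
  have letters: "D (word [a]) (word [b]) = E (word [a]) (word [b])" for a b
  proof -
    have "F gen_x_star gen_x = - flip (1 \<otimes> 1)" if F: "is_symplectic_double_bracket F" for F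
      using swap[OF F, of gen_x_star gen_x] gens[OF F] by simp
    then have "D gen_x_star gen_x = E gen_x_star gen_x"
      using D E by metis
    then show ?thesis
      using gens[OF D] gens[OF E]
      by (cases a; cases b) (simp_all add: gen_x_def gen_x_star_def)
  qed
  have "D (word [a]) (word v) = E (word [a]) (word v)" for a v
    by (rule extend) (rule letters)
  then have "D (word v) (word [a]) = E (word v) (word [a])" for a v
    using swap[OF D] swap[OF E] by metis
  then have words: "D (word u) (word v) = E (word u) (word v)" for u v
    by (rule extend)
  have "D a b = E a b" for a b
  proof (induction a rule: basis_induct)
    case (basis k)
    show ?case
      by (induction b rule: basis_induct) (simp_all add: words add[OF D] add[OF E] scale[OF D] scale[OF E])
  qed (simp_all add: add[OF D] add[OF E] scale[OF D] scale[OF E])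
  then show ?thesis by blast
qed

theorem ex1_symplectic_double_bracket: "\<exists>!D. is_symplectic_double_bracket D"
  using is_symplectic_double_bracket_db is_symplectic_double_bracket_unique by blast

lemma symplectic_double_bracket: "is_symplectic_double_bracket double_bracket"
  unfolding double_bracket_def by (rule theI'[OF ex1_symplectic_double_bracket])

lemma double_bracket_eq_db: "double_bracket = db"
  using symplectic_double_bracket is_symplectic_double_bracket_db
  by (rule is_symplectic_double_bracket_unique)

lemma double_bracket_swap: "double_bracket a b = - flip (double_bracket b a)"
  and double_bracket_leibniz: "double_bracket a (b * c) =
    outer_act b (double_bracket a c) 1 + outer_act 1 (double_bracket a b) c"
  using symplectic_double_bracket unfolding is_symplectic_double_bracket_def by blast+


section \<open>The necklace Lie algebra\<close>

definition commutator_space :: "falg set"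
  where "commutator_space = pm.span {a * b - b * a | a b. True}"

lemma commutator_in [simp, intro]: "a * b - b * a \<in> commutator_space"
  unfolding commutator_space_def by (rule pm.span_base) blast

lemma commutator_space_closed:
  "0 \<in> commutator_space"
  "p \<in> commutator_space \<Longrightarrow> q \<in> commutator_space \<Longrightarrow> p + q \<in> commutator_space"
  "p \<in> commutator_space \<Longrightarrow> q \<in> commutator_space \<Longrightarrow> p - q \<in> commutator_space"
  "p \<in> commutator_space \<Longrightarrow> - p \<in> commutator_space"
  "p \<in> commutator_space \<Longrightarrow> c *: p \<in> commutator_space"
  unfolding commutator_space_def
  by (simp_all add: pm.span_zero pm.span_add pm.span_diff pm.span_neg pm.span_scale)

quotient_type necklace = falg / "\<lambda>p q. p - q \<in> commutator_space"
  morphisms rep_necklace necklace_class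
proof (rule equivpI)
  show "reflp (\<lambda>p q. p - q \<in> commutator_space)"
    by (auto intro: reflpI simp: commutator_space_closed)
  show "symp (\<lambda>p q. p - q \<in> commutator_space)"
    by (rule sympI) (metis commutator_space_closed(4) minus_diff_eq)
  show "transp (\<lambda>p q. p - q \<in> commutator_space)"
    by (rule transpI) (drule (1) commutator_space_closed(2), simp)
qed

instantiation necklace :: ab_group_add
begin

lift_definition zero_necklace :: necklace is 0 .

lift_definition plus_necklace :: "necklace \<Rightarrow> necklace \<Rightarrow> necklace" is "(+)"
  by (drule (1) commutator_space_closed(2)) (simp add: algebra_simps)

lift_definition uminus_necklace :: "necklace \<Rightarrow> necklace" is uminus
  by (drule commutator_space_closed(4)) simp

lift_definition minus_necklace :: "necklace \<Rightarrow> necklace \<Rightarrow> necklace" is "(-)"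
  by (drule (1) commutator_space_closed(3)) (simp add: algebra_simps)

instance
  by standard (transfer; simp add: algebra_simps commutator_space_closed)+

end

lift_definition nscale :: "complex \<Rightarrow> necklace \<Rightarrow> necklace" is pscale
  by (metis commutator_space_closed(5) pm.scale_right_diff_distrib)

interpretation neck: vector_space nscale
  by unfold_locales (transfer; simp add: algebra_simps commutator_space_closed pm.scale_right_distrib
      pm.scale_left_distrib)+

lemma mul_map_flip: "mul_map (flip t) - mul_map t \<in> commutator_space"
proof (induction t rule: basis_induct)
  case (basis k)
  then show ?case by (cases k) (auto simp flip: word_mult)
next
  case (scale c t)
  then show ?case using commutator_space_closed(5)[OF scale, of c]
    by (simp add: pm.scale_right_diff_distrib)
next
  case (add s t)
  then show ?case by (metis add_diff_add commutator_space_closed(2) flip_simps(1) mul_map_simps(1))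
qed

definition pre_bracket :: "falg \<Rightarrow> falg \<Rightarrow> falg"
  where "pre_bracket a b = mul_map (double_bracket a b)"

lemma pre_bracket_simps:
  "pre_bracket (a + a') b = pre_bracket a b + pre_bracket a' b"
  "pre_bracket a (b + b') = pre_bracket a b + pre_bracket a b'"
  "pre_bracket (c *: a) b = c *: pre_bracket a b"
  "pre_bracket a (c *: b) = c *: pre_bracket a b"
  by (simp_all add: pre_bracket_def double_bracket_eq_db)

lemma pre_bracket_diff:
  "pre_bracket (a - a') b = pre_bracket a b - pre_bracket a' b"
  "pre_bracket a (b - b') = pre_bracket a b - pre_bracket a b'"
  by (metis diff_add_cancel add_diff_cancel pre_bracket_simps(1))
    (metis diff_add_cancel add_diff_cancel pre_bracket_simps(2))

lemma pre_bracket_swap: "pre_bracket a b + pre_bracket b a \<in> commutator_space"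
proof -
  have "pre_bracket a b + pre_bracket b a =
      - (mul_map (flip (double_bracket b a)) - mul_map (double_bracket b a))"
    by (simp add: pre_bracket_def double_bracket_swap[of a b])
  then show ?thesis by (simp only: mul_map_flip commutator_space_closed(4))
qed

lemma pre_bracket_mult: "pre_bracket a (b * c) = b * pre_bracket a c + pre_bracket a b * c"
  by (simp add: pre_bracket_def double_bracket_leibniz mul_map_outer_act)

lemma pre_bracket_commutator_space_right:
  assumes "b \<in> commutator_space"
  shows "pre_bracket a b \<in> commutator_space"
proof -
  have "b \<in> pm.span {a * b - b * a | a b. True}"
    using assms by (simp only: commutator_space_def)
  then show ?thesis
  proof (induction rule: pm.span_induct_alt)
    case base
    have "pre_bracket a 0 = 0" using pre_bracket_diff(2)[of a 0 0] by simp
    then show ?case by (simp add: commutator_space_closed)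
  next
    case (step c x y)
    then obtain p q where x: "x = p * q - q * p" by blast
    have "pre_bracket a x = (p * pre_bracket a q - pre_bracket a q * p)
        + (pre_bracket a p * q - q * pre_bracket a p)"
      by (simp add: x pre_bracket_diff pre_bracket_mult)
    then have "pre_bracket a x \<in> commutator_space"
      by (simp only: commutator_in commutator_space_closed(2))
    then show ?case
      using step.IH by (simp add: pre_bracket_simps commutator_space_closed)
  qed
qed

lemma pre_bracket_commutator_space_left:
  assumes "a \<in> commutator_space"
  shows "pre_bracket a b \<in> commutator_space"
  using commutator_space_closed(3)[OF pre_bracket_swap[of a b]
      pre_bracket_commutator_space_right[OF assms, of b]]
  by simp

lift_definition necklace_bracket :: "necklace \<Rightarrow> necklace \<Rightarrow> necklace"
  is "\<lambda>a b. mul_map (double_bracket a b)"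
proof -
  fix a a' b b' :: falg
  assume a: "a - a' \<in> commutator_space" and b: "b - b' \<in> commutator_space"
  have "pre_bracket a b - pre_bracket a' b' = pre_bracket (a - a') b + pre_bracket a' (b - b')"
    by (simp add: pre_bracket_diff)
  also have "\<dots> \<in> commutator_space"
    by (intro commutator_space_closed(2) pre_bracket_commutator_space_left
        pre_bracket_commutator_space_right a b)
  finally show "mul_map (double_bracket a b) - mul_map (double_bracket a' b') \<in> commutator_space"
    by (simp add: pre_bracket_def)
qed

lemma necklace_bracket_class:
  "necklace_bracket (necklace_class a) (necklace_class b) =
    necklace_class (mul_map (double_bracket a b))"
  by (rule necklace_bracket.abs_eq)

lemma necklace_bracket_simps:
  "necklace_bracket (a + a') b = necklace_bracket a b + necklace_bracket a' b"
  "necklace_bracket a (b + b') = necklace_bracket a b + necklace_bracket a b'"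
  "necklace_bracket (nscale c a) b = nscale c (necklace_bracket a b)"
  "necklace_bracket a (nscale c b) = nscale c (necklace_bracket a b)"
  by (transfer; simp add: pre_bracket_simps commutator_space_closed flip: pre_bracket_def)+

lemma necklace_bracket_swap: "necklace_bracket a b = - necklace_bracket b a"
  by transfer (use pre_bracket_swap in \<open>simp add: pre_bracket_def\<close>)

definition necklace_center :: "necklace set"
  where "necklace_center = {z. \<forall>y. necklace_bracket z y = 0}"

lemma subspace_necklace_center: "neck.subspace necklace_center"
proof -
  have "necklace_bracket 0 y = 0" for y
    using necklace_bracket_simps(1)[of 0 0 y] by simp
  then show ?thesis
    unfolding neck.subspace_def necklace_center_def by (simp add: necklace_bracket_simps)
qed

definition necklace_c :: "nat \<Rightarrow> necklace"
  where "necklace_c n = necklace_class ((gen_x * gen_x_star - gen_x_star * gen_x) ^ n)"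

definition infinite_dimensional :: "necklace set \<Rightarrow> bool"
  where "infinite_dimensional V \<longleftrightarrow> \<not> (\<exists>B. finite B \<and> V \<subseteq> neck.span B)"

end

(* Write w = x x* - x* x.  By induction on words, {{a, w}} = a (x) 1 - 1 (x) a, which the
   multiplication map kills; since a' \<mapsto> \<mu> {{a, a'}} is a derivation, \<mu> {{a, w^n}} = 0 for
   all n, so c_n is central.

   For independence, represent the free algebra on 3 x 3 matrices by truncating the Weyl algebra to
   span(1, t, t^2): then w acts as diag(1, 1, -2), so the trace, which descends to A/[A,A], takes
   the value 2 + (-2)^n at c_n, nonzero for n > 1.  Recording word lengths in addition, the graded
   trace of c_n is (2 + (-2)^n) T^(2n), and these monomials have distinct degrees. *)

theory Submission
  imports Defs
begin

section \<open>Centrality\<close>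

abbreviation gen_commutator :: falg
  where "gen_commutator \<equiv> gen_x * gen_x_star - gen_x_star * gen_x"

lemma gen_commutator_eq: "gen_commutator = word [X, X_star] - word [X_star, X]"
  by (simp add: gen_x_def gen_x_star_def)

lemma db_diff_right: "db a (b - b') = db a b - db a b'"
  using db_simps(2)[of a "b - b'" b'] by (simp add: algebra_simps)

text \<open>The single-letter case is a direct computation; the recursion of \<open>db_word\<close>
  in its first argument then telescopes.\<close>

lemma db_word_gen_commutator:
  "db_word u [X, X_star] - db_word u [X_star, X] = word2 u [] - word2 [] u"
proof (induction u)
  case Nil
  show ?case by simp
next
  case (Cons a u)
  have letter: "db_letter a [X, X_star] - db_letter a [X_star, X] = word2 [a] [] - word2 [] [a]"
    by (cases a) (simp_all flip: one_falg2)
  have "db_word (a # u) [X, X_star] - db_word (a # u) [X_star, X] =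
      (db_letter a [X, X_star] - db_letter a [X_star, X]) * word2 u [] +
      word2 [] [a] * (db_word u [X, X_star] - db_word u [X_star, X])"
    by (simp only: db_word.simps algebra_simps)
  \<comment> \<open>The two terms \<open>word2 u [a]\<close> have opposite signs and cancel.\<close>
  also have "\<dots> = word2 (a # u) [] - word2 [] (a # u)"
    unfolding letter Cons by (simp add: algebra_simps)
  finally show ?case .
qed

text \<open>Vanishing in the free algebra itself is what passes to powers:
  \<open>commutator_space\<close> is not an ideal, so vanishing modulo commutators would not
  suffice.\<close>

lemma pre_bracket_gen_commutator: "pre_bracket a gen_commutator = 0"
proof (induction a rule: basis_induct)
  case (basis u)
  have "double_bracket (word u) gen_commutator = word2 u [] - word2 [] u"
    by (simp add: double_bracket_eq_db gen_commutator_eq db_diff_right db_word_gen_commutator)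
  then show ?case by (simp add: pre_bracket_def)
qed (simp_all add: pre_bracket_simps)

lemma pre_bracket_power:
  assumes "pre_bracket a b = 0"
  shows "pre_bracket a (b ^ n) = 0"
proof (induction n)
  case 0
  \<comment> \<open>The Leibniz rule on \<open>1 * 1\<close> reads d = d + d.\<close>
  show ?case using pre_bracket_mult[of a 1 1] by simp
next
  case (Suc n)
  then show ?case by (simp add: pre_bracket_mult assms)
qed

lemma necklace_c_central: "necklace_c n \<in> necklace_center"
proof -
  have "necklace_bracket y (necklace_c n) = 0" for y
  proof (induction y rule: necklace.abs_induct)
    case (1 a)
    have "mul_map (double_bracket a (gen_commutator ^ n)) = 0"
      using pre_bracket_power[OF pre_bracket_gen_commutator] by (simp add: pre_bracket_def)
    then show ?case
      by (simp only: necklace_c_def necklace_bracket_class zero_necklace.abs_eq)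
  qed
  \<comment> \<open>The center is defined through the first slot; antisymmetry moves the computation
    there.\<close>
  then show ?thesis
    unfolding necklace_center_def using necklace_bracket_swap[of "necklace_c n"] by simp
qed


section \<open>The graded trace\<close>

text \<open>In the basis t^j / j!, with row i and column j, \<open>X\<close> is d/dt and
  \<open>X_star\<close> is multiplication by t. Summing over indices below 3 in
  \<open>word_entry\<close> imposes t^3 = 0.\<close>

fun letter_entry :: "letter \<Rightarrow> nat \<Rightarrow> nat \<Rightarrow> complex" where
  "letter_entry X i j = (if j = Suc i then 1 else 0)"
| "letter_entry X_star i j = (if i = Suc j then of_nat i else 0)"

fun word_entry :: "letter list \<Rightarrow> nat \<Rightarrow> nat \<Rightarrow> complex" where
  "word_entry [] i j = (if i = j then 1 else 0)"
| "word_entry (a # u) i j = (\<Sum>k<3. letter_entry a i k * word_entry u k j)"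

text \<open>The bound on \<open>i\<close> serves the empty prefix, where the sum must contain the
  index \<open>k = i\<close>.\<close>

lemma word_entry_append:
  assumes "i < 3"
  shows "word_entry (u @ v) i j = (\<Sum>k<3. word_entry u i k * word_entry v k j)"
  using assms
proof (induction u arbitrary: i)
  case Nil
  have "(\<Sum>k<3. word_entry [] i k * word_entry v k j)
      = (\<Sum>k<3. if i = k then word_entry v k j else 0)"
    by (intro sum.cong) auto
  then show ?case using Nil by simp
next
  case (Cons a u)
  have "word_entry ((a # u) @ v) i j
      = (\<Sum>l<3. \<Sum>k<3. letter_entry a i l * (word_entry u l k * word_entry v k j))"
    by (simp add: Cons.IH sum_distrib_left)
  also have "\<dots> = (\<Sum>k<3. \<Sum>l<3. letter_entry a i l * (word_entry u l k * word_entry v k j))"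
    by (rule sum.swap)
  finally show ?case by (simp add: sum_distrib_right mult.assoc)
qed

text \<open>Polynomials in a degree-counting variable are encoded as \<open>nat \<Rightarrow>\<^sub>0 complex\<close>.\<close>

definition graded_entry :: "nat \<Rightarrow> nat \<Rightarrow> falg \<Rightarrow> (nat \<Rightarrow>\<^sub>0 complex)"
  where "graded_entry i j = lin_ext (\<lambda>u. Poly_Mapping.single (length u) (word_entry u i j))"

lemma graded_entry_simps [simp]:
  "graded_entry i j (p + q) = graded_entry i j p + graded_entry i j q"
  "graded_entry i j (p - q) = graded_entry i j p - graded_entry i j q"
  "graded_entry i j (c *: p) = c *: graded_entry i j p"
  "graded_entry i j (word u) = Poly_Mapping.single (length u) (word_entry u i j)"
  by (simp_all add: graded_entry_def)

lemma single_sum: "Poly_Mapping.single k (sum f A) = (\<Sum>a\<in>A. Poly_Mapping.single k (f a))"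
  by (induction A rule: infinite_finite_induct) (simp_all add: single_add)

text \<open>Matrix multiplicativity and additivity of word length combine into multiplicativity over
  polynomials in T.\<close>

lemma graded_entry_mult:
  assumes "i < 3"
  shows "graded_entry i j (p * q) = (\<Sum>k<3. graded_entry i k p * graded_entry k j q)"
proof (induction p rule: basis_induct)
  case (basis u)
  show ?case
  proof (induction q rule: basis_induct)
    case (basis v)
    show ?case
      by (simp add: word_entry_append[OF assms] mult_single single_sum plus_list_def)
  qed (simp_all add: algebra_simps sum.distrib pm.scale_sum_right)
qed (simp_all add: algebra_simps sum.distrib pm.scale_sum_right)

definition graded_trace :: "falg \<Rightarrow> (nat \<Rightarrow>\<^sub>0 complex)"
  where "graded_trace p = (\<Sum>i<3. graded_entry i i p)"

lemma graded_trace_simps [simp]: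
  "graded_trace (p + q) = graded_trace p + graded_trace q"
  "graded_trace (p - q) = graded_trace p - graded_trace q"
  "graded_trace (c *: p) = c *: graded_trace p"
  by (simp_all add: graded_trace_def sum.distrib sum_subtractf pm.scale_sum_right)

text \<open>The usual cyclicity of the trace: the matrices have entries in a commutative polynomial
  ring.\<close>

lemma graded_trace_commute: "graded_trace (p * q) = graded_trace (q * p)"
proof -
  have "graded_trace (p * q) = (\<Sum>i<3. \<Sum>k<3. graded_entry i k p * graded_entry k i q)"
    by (simp add: graded_trace_def graded_entry_mult)
  also have "\<dots> = (\<Sum>k<3. \<Sum>i<3. graded_entry i k p * graded_entry k i q)"
    by (rule sum.swap)
  also have "\<dots> = graded_trace (q * p)"
    by (simp add: graded_trace_def graded_entry_mult mult.commute)
  finally show ?thesis .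
qed

lemma graded_trace_commutator_space:
  assumes "p \<in> commutator_space"
  shows "graded_trace p = 0"
proof -
  have "p \<in> pm.span {a * b - b * a | a b. True}"
    using assms by (simp only: commutator_space_def)
  then show ?thesis
  proof (induction rule: pm.span_induct_alt)
    case base
    show ?case using graded_trace_simps(2)[of 0 0] by simp
  next
    case (step c p q)
    then show ?case by (auto simp: graded_trace_commute)
  qed
qed

lift_definition necklace_trace :: "necklace \<Rightarrow> (nat \<Rightarrow>\<^sub>0 complex)" is graded_trace
  using graded_trace_commutator_space by fastforce

lemma necklace_trace_simps [simp]:
  "necklace_trace (a + b) = necklace_trace a + necklace_trace b"
  "necklace_trace (nscale c a) = c *: necklace_trace a"
  by (transfer; simp)+

lemma necklace_trace_0 [simp]: "necklace_trace 0 = 0"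
  using necklace_trace_simps(1)[of 0 0] by simp

section \<open>Traces of the powers of the commutator\<close>

definition commutator_eigenvalue :: "nat \<Rightarrow> complex"
  where "commutator_eigenvalue i = (if i = 2 then - 2 else 1)"

text \<open>On 1 and t the Weyl relation survives and gives eigenvalue 1. On t^2 multiplication by t
  is truncated to 0, so only - t d/dt acts, with eigenvalue -2.\<close>

lemma graded_entry_gen_commutator:
  assumes "i < 3" "j < 3"
  shows "graded_entry i j gen_commutator =
    (if i = j then Poly_Mapping.single 2 (commutator_eigenvalue i) else 0)"
proof -
  have i: "i \<in> {0, 1, 2}" and j: "j \<in> {0, 1, 2}" using assms by auto
  have "word_entry [X, X_star] i j - word_entry [X_star, X] i j =
      (if i = j then commutator_eigenvalue i else 0)"
    using i j by (auto simp: commutator_eigenvalue_def eval_nat_numeral)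
  then show ?thesis
    by (simp add: gen_commutator_eq numeral_2_eq_2 del: word_entry.simps flip: single_diff)
qed

lemma graded_entry_gen_commutator_power:
  assumes "i < 3" "j < 3"
  shows "graded_entry i j (gen_commutator ^ n) =
    (if i = j then Poly_Mapping.single (2 * n) (commutator_eigenvalue i ^ n) else 0)"
  using assms
proof (induction n arbitrary: i)
  case 0
  show ?case by (simp add: one_falg)
next
  case (Suc n)
  have "graded_entry i j (gen_commutator ^ Suc n) =
      (\<Sum>k<3. graded_entry i k gen_commutator * graded_entry k j (gen_commutator ^ n))"
    by (simp only: power_Suc graded_entry_mult[OF Suc.prems(1)])
  also have "\<dots> = (\<Sum>k<3. if i = k then Poly_Mapping.single 2 (commutator_eigenvalue i) *
      graded_entry k j (gen_commutator ^ n) else 0)"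
    using Suc.prems
    by (intro sum.cong)
      (auto simp only: graded_entry_gen_commutator lessThan_iff mult_zero_left split: if_splits)
  also have "\<dots> = Poly_Mapping.single 2 (commutator_eigenvalue i) *
      graded_entry i j (gen_commutator ^ n)"
    using Suc.prems by simp
  finally show ?case
    by (simp only: Suc.IH[OF Suc.prems]) (simp add: mult_single)
qed

text \<open>The coefficient is the power sum of the eigenvalues 1, 1, -2. It vanishes at n = 1,
  where the class is that of a commutator.\<close>

lemma necklace_trace_c:
  "necklace_trace (necklace_c n) = Poly_Mapping.single (2 * n) (2 + (- 2) ^ n)"
proof -
  have "graded_trace (gen_commutator ^ n) =
      (\<Sum>i<3. Poly_Mapping.single (2 * n) (commutator_eigenvalue i ^ n))"
    unfolding graded_trace_def
    by (intro sum.cong refl) (simp only: graded_entry_gen_commutator_power lessThan_iff simp_thms if_True)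
  also have "\<dots> = Poly_Mapping.single (2 * n) (2 + (- 2) ^ n)"
    unfolding single_sum[symmetric] by (simp add: numeral_3_eq_3 commutator_eigenvalue_def)
  finally show ?thesis
    by (simp only: necklace_c_def necklace_trace.abs_eq)
qed

lemma trace_coefficient_nonzero:
  assumes "n > 1"
  shows "2 + (- 2) ^ n \<noteq> (0 :: complex)"
proof
  assume "2 + (- 2) ^ n = (0 :: complex)"
  \<comment> \<open>Comparing absolute values turns the equation into 2^n = 2.\<close>
  then have "norm ((- 2 :: complex) ^ n) = norm (- 2 :: complex)"
    by (metis add_eq_0_iff)
  then have "(2 :: real) ^ n = 2 ^ 1" by (simp add: norm_power)
  then show False using assms by (simp only: power_inject_exp)
qed

lemma keys_necklace_trace_c:
  assumes "n > 1"
  shows "Poly_Mapping.keys (necklace_trace (necklace_c n)) = {2 * n}"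
  using trace_coefficient_nonzero[OF assms] by (simp add: necklace_trace_c)

section \<open>Infinite dimension by unbounded degrees\<close>

lemma finite_keys_necklace_trace_span:
  assumes "finite B"
  shows "\<exists>K. finite K \<and> (\<forall>a\<in>neck.span B. Poly_Mapping.keys (necklace_trace a) \<subseteq> K)"
proof -
  let ?K = "\<Union>b\<in>B. Poly_Mapping.keys (necklace_trace b)"
  have "Poly_Mapping.keys (necklace_trace a) \<subseteq> ?K" if "a \<in> neck.span B" for a
    using that
  proof (induction rule: neck.span_induct_alt)
    case base
    show ?case by simp
  next
    case (step c b a)
    have "Poly_Mapping.keys (necklace_trace (nscale c b + a)) \<subseteq>
        Poly_Mapping.keys (necklace_trace b) \<union> Poly_Mapping.keys (necklace_trace a)"
      by (auto simp: in_keys_iff lookup_add)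
    then show ?case using step by blast
  qed
  then show ?thesis using assms by (intro exI[of _ ?K]) auto
qed

lemma infinite_dimensional_necklace_center: "infinite_dimensional necklace_center"
  unfolding infinite_dimensional_def
proof
  assume "\<exists>B. finite B \<and> necklace_center \<subseteq> neck.span B"
  then obtain K where "finite K"
    and K: "\<And>a. a \<in> necklace_center \<Longrightarrow> Poly_Mapping.keys (necklace_trace a) \<subseteq> K"
    using finite_keys_necklace_trace_span by (meson subsetD)
  \<comment> \<open>Each central class with n > 1 forces its degree 2n into the finite set
    \<open>K\<close>.\<close>
  have "(*) 2 ` {1<..} \<subseteq> K"
    using K[OF necklace_c_central] keys_necklace_trace_c by fastforce
  then have "finite ((*) (2 :: nat) ` {1<..})"
    using \<open>finite K\<close> finite_subset by blast
  then have "finite {1 :: nat<..}"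
    by (rule finite_imageD) (simp add: inj_on_def)
  then show False by (simp add: infinite_Ioi)
qed

theorem theorem6:
  shows "(\<forall>n::nat. necklace_c n \<in> necklace_center) \<and>
    inj_on necklace_c {n. n > 1} \<and>
    (\<forall>n>1. necklace_c n \<noteq> 0) \<and>
    infinite_dimensional necklace_center"
proof (intro conjI allI impI)
  show "necklace_c n \<in> necklace_center" for n by (rule necklace_c_central)
  show "inj_on necklace_c {n. n > 1}"
  proof (rule inj_onI)
    fix m n :: nat
    assume "m \<in> {n. n > 1}" "n \<in> {n. n > 1}" "necklace_c m = necklace_c n"
    \<comment> \<open>Equal classes have equal traces, hence the same single degree.\<close>
    then have "{2 * m} = {2 * n}" using keys_necklace_trace_c by (metis mem_Collect_eq)
    then show "m = n" by simp
  qed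
  show "necklace_c n \<noteq> 0" if "n > 1" for n
    using keys_necklace_trace_c[OF that] by auto
  show "infinite_dimensional necklace_center" by (rule infinite_dimensional_necklace_center)
qed

end
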